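(* Let $\delta>0$ and let $u\in\mathbb{R}^q$. Then the composition $\psi_\delta(u)=h_\delta(\|u\|)$ of the Huber function of radius $\delta$ with the Euclidean norm can be written as $$\psi_\delta(u)=\|u\|^2-\mathrm{d}_\delta^2(u),$$ where $\mathrm{d}_\delta^2(u)$ denotes the squared Euclidean distance from $u$ to the closed ball of radius $\delta$ centered at the origin of $\mathbb{R}^q$.
   Context: The Huber function of radius $\delta>0$ is $h_\delta:\mathbb{R}\to\mathbb{R}$, $h_\delta(s)=s^2$ if $|s|\le\delta$ and $h_\delta(s)=2\delta|s|-\delta^2$ if $|s|\ge\delta$. $\|\cdot\|$ is the Euclidean norm. The squared distance to the ball is $\mathrm{d}_\delta^2(u)=\min_{\|v\|\le\delta}\|u-v\|^2$. *)

theory Defs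
  imports "HOL-Analysis.Analysis"
begin

(* The two branches of the Huber function agree when \<bar>s\<bar> = \<delta>. *)
definition huber :: "real \<Rightarrow> real \<Rightarrow> real" where
  "huber \<delta> s = (if \<bar>s\<bar> \<le> \<delta> then s\<^sup>2 else 2 * \<delta> * \<bar>s\<bar> - \<delta>\<^sup>2)"

lemma huber_inner: "\<bar>s\<bar> \<le> \<delta> \<Longrightarrow> huber \<delta> s = s\<^sup>2"
  by (simp add: huber_def)

lemma huber_outer:
  assumes "\<bar>s\<bar> \<ge> \<delta>"
  shows "huber \<delta> s = 2 * \<delta> * \<bar>s\<bar> - \<delta>\<^sup>2"
proof (cases "\<bar>s\<bar> = \<delta>")
  case True
  then have "s\<^sup>2 = \<delta>\<^sup>2" by auto
  with True show ?thesis by (simp add: huber_def power2_eq_square)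
next
  case False
  with assms show ?thesis by (simp add: huber_def)
qed

definition huber_norm :: "real \<Rightarrow> real ^ 'q \<Rightarrow> real" where
  "huber_norm \<delta> u = huber \<delta> (norm u)"

(* The infimum is a minimum for \<delta> \<ge> 0, see ball_dist_sq_attained. *)
definition ball_dist_sq :: "real \<Rightarrow> real ^ 'q \<Rightarrow> real" where
  "ball_dist_sq \<delta> u = (INF v \<in> {v. norm v \<le> \<delta>}. (norm (u - v))\<^sup>2)"

lemma ball_dist_sq_attained:
  fixes u :: "real ^ 'q"
  assumes "\<delta> \<ge> 0"
  shows "\<exists>v. norm v \<le> \<delta> \<and> ball_dist_sq \<delta> u = (norm (u - v))\<^sup>2 \<and>
           (\<forall>w. norm w \<le> \<delta> \<longrightarrow> (norm (u - v))\<^sup>2 \<le> (norm (u - w))\<^sup>2)"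
proof -
  have "compact (cball (0 :: real ^ 'q) \<delta>)" "cball (0 :: real ^ 'q) \<delta> \<noteq> {}"
    using assms by auto
  moreover have "continuous_on (cball 0 \<delta>) (\<lambda>v. (norm (u - v))\<^sup>2)"
    by (intro continuous_intros)
  ultimately obtain v where v: "v \<in> cball 0 \<delta>"
    and min: "\<forall>w \<in> cball 0 \<delta>. (norm (u - v))\<^sup>2 \<le> (norm (u - w))\<^sup>2"
    using continuous_attains_inf by blast
  have "ball_dist_sq \<delta> u = (norm (u - v))\<^sup>2"
    unfolding ball_dist_sq_def
    by (rule cInf_eq_minimum) (use v min in auto)
  with v min show ?thesis by auto
qed

end

theory Submission
  imports Defs
begin

text \<open>
  By the reverse triangle inequality no point of the ball is closer to \<open>u\<close> than
  \<open>norm u - \<delta>\<close>, and the radial projection of \<open>u\<close> onto the ball attains this bound; so the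
  distance to the ball is the positive part of \<open>norm u - \<delta>\<close> (lemma \<open>ball_dist_sq_eq\<close>).
  The claim thus concerns the number \<open>s = norm u\<close> alone: for \<open>s \<le> \<delta>\<close> the distance vanishes
  and \<open>s\<^sup>2\<close> remains, while for \<open>s > \<delta>\<close> expanding \<open>s\<^sup>2 - (s - \<delta>)\<^sup>2\<close> gives the linear branch
  \<open>2 * \<delta> * s - \<delta>\<^sup>2\<close> of the Huber function.
\<close>

text \<open>
  The minimizer is \<open>u\<close> itself inside the ball and the rescaling of \<open>u\<close> to norm \<open>\<delta>\<close> outside.
\<close>

lemma ball_dist_sq_eq:
  fixes u :: "real ^ 'q"
  assumes "\<delta> \<ge> 0"
  shows "ball_dist_sq \<delta> u = (max 0 (norm u - \<delta>))\<^sup>2"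
  unfolding ball_dist_sq_def
proof (rule cInf_eq_minimum)
  show "(max 0 (norm u - \<delta>))\<^sup>2 \<in> (\<lambda>v. (norm (u - v))\<^sup>2) ` {v. norm v \<le> \<delta>}"
  proof (cases "norm u \<le> \<delta>")
    case True
    then show ?thesis by (auto intro!: image_eqI[where x = u])
  next
    case False
    let ?v = "(\<delta> / norm u) *\<^sub>R u"
    have pos: "norm u > 0" using False assms by linarith
    have "u - ?v = (1 - \<delta> / norm u) *\<^sub>R u"
      by (simp add: scaleR_diff_left)
    moreover have "1 - \<delta> / norm u \<ge> 0"
      using False pos by (simp add: field_simps)
    ultimately have "norm (u - ?v) = (1 - \<delta> / norm u) * norm u"
      by simp
    also have "\<dots> = norm u - \<delta>"
      using pos by (simp add: field_simps)
    finally have "norm (u - ?v) = max 0 (norm u - \<delta>)"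
      using False by simp
    moreover have "norm ?v \<le> \<delta>"
      using assms pos by simp
    ultimately show ?thesis
      by (intro image_eqI[where x = ?v]) auto
  qed
next
  fix x assume "x \<in> (\<lambda>v. (norm (u - v))\<^sup>2) ` {v. norm v \<le> \<delta>}"
  then obtain v where v: "norm v \<le> \<delta>" and x: "x = (norm (u - v))\<^sup>2"
    by auto
  have "max 0 (norm u - \<delta>) \<le> norm (u - v)"
    using norm_triangle_ineq2[of u v] v by simp
  then show "(max 0 (norm u - \<delta>))\<^sup>2 \<le> x"
    unfolding x by (intro power_mono) auto
qed

theorem proposition1:
  fixes \<delta> :: real and u :: "real ^ 'q"
  assumes "\<delta> > 0"
  shows "huber_norm \<delta> u = (norm u)\<^sup>2 - ball_dist_sq \<delta> u"
proof (cases "norm u \<le> \<delta>")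
  case True
  then show ?thesis
    using assms by (simp add: huber_norm_def huber_inner ball_dist_sq_eq)
next
  case False
  then show ?thesis
    using assms
    by (simp add: huber_norm_def huber_outer ball_dist_sq_eq power2_eq_square algebra_simps)
qed

end
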